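(* For every skew shape $\lambda/\mu$, the formal power series $g_{\lambda/\mu}(x_1,x_2,\dots)$ is a symmetric function.
   Context: Young diagrams are drawn in English notation. A reverse plane partition $T$ of skew shape $\lambda/\mu$ is a filling of the boxes of $\lambda/\mu$ with positive integers that is weakly increasing along rows (left to right) and down columns. Define $x^T=\prod_{i\ge1}x_i^{T(i)}$, where $T(i)$ is the number of columns of $T$ containing one or more entries equal to $i$. Then $g_{\lambda/\mu}(x_1,x_2,\dots)=\sum_T x^T$, the sum being over all reverse plane partitions $T$ of shape $\lambda/\mu$. *)

theory Defs
  imports "HOL-Library.Poly_Mapping" "HOL-Library.FuncSet" "HOL-Combinatorics.Permutations"
begin

definition is_partition :: "nat list \<Rightarrow> bool" where
  "is_partition lam \<longleftrightarrow> sorted_wrt (\<ge>) lam \<and> 0 \<notin> set lam"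

text \<open>Box \<open>(r, c)\<close> lies in row \<open>r\<close> (counted downwards) and column \<open>c\<close> (counted to the
  right), both starting from 0.\<close>

definition young_diagram :: "nat list \<Rightarrow> (nat \<times> nat) set" where
  "young_diagram lam = {(r, c). r < length lam \<and> c < lam ! r}"

definition is_skew_shape :: "nat list \<Rightarrow> nat list \<Rightarrow> bool" where
  "is_skew_shape lam mu \<longleftrightarrow>
     is_partition lam \<and> is_partition mu \<and> young_diagram mu \<subseteq> young_diagram lam"

definition skew_diagram :: "nat list \<Rightarrow> nat list \<Rightarrow> (nat \<times> nat) set" where
  "skew_diagram lam mu = young_diagram lam - young_diagram mu"

text \<open>Fillings are extensional (\<open>undefined\<close> outside the shape), so that each reverse plane
  partition is represented by exactly one function.\<close>

definition rpps :: "nat list \<Rightarrow> nat list \<Rightarrow> (nat \<times> nat \<Rightarrow> nat) set" where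
  "rpps lam mu = {T \<in> skew_diagram lam mu \<rightarrow>\<^sub>E {1..}.
     (\<forall>r c c'. (r, c) \<in> skew_diagram lam mu \<and> (r, c') \<in> skew_diagram lam mu \<and> c \<le> c'
        \<longrightarrow> T (r, c) \<le> T (r, c')) \<and>
     (\<forall>r r' c. (r, c) \<in> skew_diagram lam mu \<and> (r', c) \<in> skew_diagram lam mu \<and> r \<le> r'
        \<longrightarrow> T (r, c) \<le> T (r', c))}"

definition num_columns_containing ::
    "nat list \<Rightarrow> nat list \<Rightarrow> (nat \<times> nat \<Rightarrow> nat) \<Rightarrow> nat \<Rightarrow> nat" where
  "num_columns_containing lam mu T i =
     card {c. \<exists>r. (r, c) \<in> skew_diagram lam mu \<and> T (r, c) = i}"

text \<open>A monomial is represented by its exponent vector, and a power series by its coefficients.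
  The variables are \<open>x\<^sub>1, x\<^sub>2, \<dots>\<close>; index 0 is unused.\<close>

type_synonym monom = "nat \<Rightarrow>\<^sub>0 nat"
type_synonym power_series = "monom \<Rightarrow> int"

definition rpp_monom :: "nat list \<Rightarrow> nat list \<Rightarrow> (nat \<times> nat \<Rightarrow> nat) \<Rightarrow> monom" where
  "rpp_monom lam mu T = Abs_poly_mapping (num_columns_containing lam mu T)"

text \<open>The coefficient of a monomial in \<open>\<Sum>T. x\<^sup>T\<close> is the number of \<open>T\<close> with that monomial,
  which is finite by \<open>finite_rpps_with_monom\<close> below.\<close>

definition dual_grothendieck :: "nat list \<Rightarrow> nat list \<Rightarrow> power_series" where
  "dual_grothendieck lam mu =
     (\<lambda>\<alpha>. int (card {T \<in> rpps lam mu. rpp_monom lam mu T = \<alpha>}))"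

definition monom_degree :: "monom \<Rightarrow> nat" where
  "monom_degree \<alpha> = (\<Sum>i\<in>Poly_Mapping.keys \<alpha>. Poly_Mapping.lookup \<alpha> i)"

text \<open>\<open>f(x\<^bsub>\<sigma> 1\<^esub>, x\<^bsub>\<sigma> 2\<^esub>, \<dots>)\<close>: the monomial with exponents \<open>\<beta> \<circ> \<sigma>\<close> in \<open>f\<close> becomes the one
  with exponents \<open>\<beta>\<close>.\<close>

definition permute_vars :: "(nat \<Rightarrow> nat) \<Rightarrow> power_series \<Rightarrow> power_series" where
  "permute_vars \<sigma> f = (\<lambda>\<beta>. f (Poly_Mapping.map_key \<sigma> \<beta>))"

text \<open>A power series in \<open>x\<^sub>1, x\<^sub>2, \<dots>\<close> (first conjunct) of bounded degree that is invariant under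
  all permutations of the variables.\<close>

definition symmetric_function :: "power_series \<Rightarrow> bool" where
  "symmetric_function f \<longleftrightarrow>
     (\<forall>\<alpha>. f \<alpha> \<noteq> 0 \<longrightarrow> Poly_Mapping.keys \<alpha> \<subseteq> {1..}) \<and>
     (\<exists>d. \<forall>\<alpha>. f \<alpha> \<noteq> 0 \<longrightarrow> monom_degree \<alpha> \<le> d) \<and>
     (\<forall>\<sigma>. \<sigma> permutes {1..} \<longrightarrow> permute_vars \<sigma> f = f)"

lemma finite_skew_diagram: "finite (skew_diagram lam mu)"
proof -
  have "young_diagram lam = (SIGMA r:{..<length lam}. {..<lam ! r})"
    by (auto simp: young_diagram_def)
  then show ?thesis by (simp add: skew_diagram_def)
qed

lemma finite_columns_containing:
  "finite {c. \<exists>r. (r, c) \<in> skew_diagram lam mu \<and> T (r, c) = i}"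
  by (rule finite_subset[OF _ finite_imageI[OF finite_skew_diagram, where h = snd]]) force

lemma num_columns_containing_eq_0_iff:
  "num_columns_containing lam mu T i = 0 \<longleftrightarrow> i \<notin> T ` skew_diagram lam mu"
  unfolding num_columns_containing_def
  using finite_columns_containing[of lam mu T i] by force

lemma lookup_rpp_monom:
  "Poly_Mapping.lookup (rpp_monom lam mu T) = num_columns_containing lam mu T"
proof -
  have "finite {i. num_columns_containing lam mu T i \<noteq> 0}"
    by (simp add: num_columns_containing_eq_0_iff finite_skew_diagram)
  then show ?thesis by (simp add: rpp_monom_def)
qed

lemma keys_rpp_monom:
  "Poly_Mapping.keys (rpp_monom lam mu T) = T ` skew_diagram lam mu"
  using num_columns_containing_eq_0_iff[of lam mu T]
  by (auto simp: in_keys_iff lookup_rpp_monom)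

lemma finite_rpps_with_monom: "finite {T \<in> rpps lam mu. rpp_monom lam mu T = \<alpha>}"
proof (rule finite_subset)
  show "{T \<in> rpps lam mu. rpp_monom lam mu T = \<alpha>}
      \<subseteq> skew_diagram lam mu \<rightarrow>\<^sub>E Poly_Mapping.keys \<alpha>"
    by (auto simp: rpps_def keys_rpp_monom PiE_def)
  show "finite (skew_diagram lam mu \<rightarrow>\<^sub>E Poly_Mapping.keys \<alpha>)"
    by (simp add: finite_PiE finite_skew_diagram)
qed

end

theory Submission
  imports Defs
begin

text \<open>It suffices to exchange \<open>x\<^sub>k\<close> and \<open>x\<^bsub>k+1\<^esub>\<close>. Fix all entries other than \<open>k\<close> and \<open>k + 1\<close>, and also
  the set of boxes that contain one of these two. In column \<open>c\<close> these boxes occupy the rows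
  \<open>s c, \<dots>, e c - 1\<close>, with \<open>s\<close> and \<open>e\<close> weakly decreasing, and a filling is a weakly decreasing sequence
  of cuts \<open>t c \<in> {s c..e c}\<close>: entries above the cut are \<open>k\<close>, those below it are \<open>k + 1\<close>. Thus
  \<open>k\<close> occurs in column \<open>c\<close> iff \<open>s c < t c\<close>, and \<open>k + 1\<close> occurs iff \<open>t c < e c\<close>. By
  inclusion-exclusion over the set of ascents of \<open>t\<close>, it is enough to count, for each set \<open>S\<close>, the
  cut sequences that increase strictly at the positions in \<open>S\<close>. Such a sequence splits into strictly
  increasing blocks, and replacing \<open>t c\<close> by \<open>s i + e j - t (i + j - c)\<close> in every block \<open>{i..j}\<close> is an
  involution that exchanges the two statistics.\<close>

subsection \<open>Cut sequences\<close>

text \<open>Inclusion-exclusion: the product of \<open>1 - of_bool (c \<in> D t)\<close> over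
  \<open>B\<close> is the indicator of \<open>D t = {}\<close>. Expand it over the subsets of
  \<open>B\<close>, sum over \<open>X\<close> and exchange the two sums.\<close>

lemma card_empty_fibre_alternating:
  assumes "finite X" "finite B" "\<And>t. t \<in> X \<Longrightarrow> D t \<subseteq> B"
  shows "int (card {t \<in> X. D t = {}}) = (\<Sum>S\<in>Pow B. (-1) ^ card S * int (card {t \<in> X. S \<subseteq> D t}))"
proof -
  have ind: "of_bool (D t = {}) = (\<Sum>S\<in>Pow B. (-1) ^ card S * of_bool (S \<subseteq> D t) :: int)"
    if t: "t \<in> X" for t
  proof -
    have "(\<Prod>c\<in>B. 1 - of_bool (c \<in> D t) :: int) = of_bool (D t = {})"
    proof (cases "D t = {}")
      case False
      then obtain c where "c \<in> D t" "c \<in> B" using assms(3)[OF t] by blast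
      then show ?thesis using assms(2) by (auto intro!: bexI[of _ c])
    qed simp
    moreover have "(\<Prod>c\<in>S. of_bool (c \<in> D t) :: int) = of_bool (S \<subseteq> D t)" if "S \<in> Pow B" for S
      using finite_subset[OF _ assms(2), of S] that by (auto simp: subset_eq)
    ultimately show ?thesis
      using prod_diff_conv_sum[OF assms(2), of "\<lambda>_. 1 :: int" "\<lambda>c. of_bool (c \<in> D t)"]
      by simp
  qed
  have count: "int (card {t \<in> X. P t}) = (\<Sum>t\<in>X. of_bool (P t))" for P
    using assms(1) by (simp add: of_bool_def sum.If_cases Int_def)
  have "int (card {t \<in> X. D t = {}}) = (\<Sum>t\<in>X. \<Sum>S\<in>Pow B. (-1) ^ card S * of_bool (S \<subseteq> D t))"
    by (simp add: count ind)
  also have "\<dots> = (\<Sum>S\<in>Pow B. \<Sum>t\<in>X. (-1) ^ card S * of_bool (S \<subseteq> D t))"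
    by (rule sum.swap)
  finally show ?thesis by (simp add: count sum_distrib_left)
qed

text \<open>Join \<open>c\<close> to \<open>Suc c\<close> for each \<open>c\<close> in
  \<open>S\<close>. Then \<open>f k\<close> and \<open>l k\<close> are the two ends of the maximal
  run through \<open>k\<close>. They agree for all positions of a run because overlapping runs
  unite.\<close>

lemma maximal_blocks:
  fixes S :: "nat set"
  assumes S: "\<And>c. c \<in> S \<Longrightarrow> Suc c < n"
  obtains f l :: "nat \<Rightarrow> nat" where
    "\<And>k. f k \<le> k" "\<And>k. k \<le> l k" "\<And>k. k < n \<Longrightarrow> l k < n" "\<And>k. {f k..<l k} \<subseteq> S"
    "\<And>k j. f k \<le> j \<Longrightarrow> j \<le> l k \<Longrightarrow> f j = f k \<and> l j = l k"
    "\<And>k. k \<in> S \<Longrightarrow> Suc k \<le> l k"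
proof
  define f where "f k = (LEAST i. {i..<k} \<subseteq> S)" for k
  define l where "l k = (GREATEST i. {k..<i} \<subseteq> S)" for k
  \<comment> \<open>This upper bound makes the \<open>GREATEST\<close> in \<open>l\<close>
    meaningful.\<close>
  have bound: "i \<le> max k n" if "{k..<i} \<subseteq> S" for k i
  proof (cases "k < i")
    case True
    then have "i - 1 \<in> S" using that by auto
    then show ?thesis using S by fastforce
  qed simp
  have f_le: "f k \<le> i" if "{i..<k} \<subseteq> S" for i k
    unfolding f_def using that by (rule Least_le)
  have f_sub: "{f k..<k} \<subseteq> S" for k
    unfolding f_def by (rule LeastI[of "\<lambda>i. {i..<k} \<subseteq> S" k]) simp
  have l_ge: "i \<le> l k" if "{k..<i} \<subseteq> S" for i k
    unfolding l_def by (rule Greatest_le_nat[where b = "max k n"]) (use that bound in auto)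
  have l_sub: "{k..<l k} \<subseteq> S" for k
    unfolding l_def by (rule GreatestI_nat[where k = k and b = "max k n"]) (use bound in auto)
  show "f k \<le> k" "k \<le> l k" for k by (simp_all add: f_le l_ge)
  show "l k < n" if "k < n" for k
  proof (cases "l k = k")
    case False
    then have "l k - 1 \<in> S" using l_sub[of k] \<open>k \<le> l k\<close> by auto
    then show ?thesis using S by fastforce
  qed (use that in simp)
  show fl: "{f k..<l k} \<subseteq> S" for k
    using f_sub[of k] l_sub[of k] by (meson atLeastLessThan_iff not_le subset_iff)
  show "f j = f k \<and> l j = l k" if j: "f k \<le> j" "j \<le> l k" for k j
  proof -
    have "{f k..<j} \<subseteq> S" "{j..<l k} \<subseteq> S" using fl[of k] j by auto
    moreover have "{f j..<k} \<subseteq> S"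
      using f_sub[of j] fl[of k] j \<open>k \<le> l k\<close> by (auto simp: subset_iff) (meson not_le order.strict_trans2 le_less_trans)
    moreover have "{k..<l j} \<subseteq> S"
      using l_sub[of j] fl[of k] j \<open>f k \<le> k\<close> by (auto simp: subset_iff) (meson not_le le_trans less_le_trans)
    ultimately show ?thesis by (simp add: antisym f_le l_ge)
  qed
  show "Suc k \<le> l k" if "k \<in> S" for k using that by (intro l_ge) (auto simp: less_Suc_eq)
qed

text \<open>The block reversal stays within the bounds because \<open>s\<close> and \<open>e\<close> decrease: the entries of a block
  \<open>{i..j}\<close> lie between \<open>s i\<close> and \<open>e j\<close>, and only \<open>t i\<close> can attain its lower and only \<open>t j\<close> its upper
  bound.\<close>

lemma card_block_increasing_swap:
  fixes s e :: "nat \<Rightarrow> nat"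
  assumes anti: "\<And>c d. c \<le> d \<Longrightarrow> d < n \<Longrightarrow> s d \<le> s c" "\<And>c d. c \<le> d \<Longrightarrow> d < n \<Longrightarrow> e d \<le> e c"
    and S: "\<And>c. c \<in> S \<Longrightarrow> Suc c < n"
  shows "card {t \<in> PiE {..<n} (\<lambda>c. {s c..e c}). (\<forall>c\<in>S. t c < t (Suc c)) \<and>
           card {c. c < n \<and> s c < t c} = a \<and> card {c. c < n \<and> t c < e c} = b} =
         card {t \<in> PiE {..<n} (\<lambda>c. {s c..e c}). (\<forall>c\<in>S. t c < t (Suc c)) \<and>
           card {c. c < n \<and> s c < t c} = b \<and> card {c. c < n \<and> t c < e c} = a}"
proof -
  obtain f l :: "nat \<Rightarrow> nat" where
    fl: "\<And>k. f k \<le> k" "\<And>k. k \<le> l k" "\<And>k. k < n \<Longrightarrow> l k < n" "\<And>k. {f k..<l k} \<subseteq> S"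
      and fl_eq: "\<And>k j. f k \<le> j \<Longrightarrow> j \<le> l k \<Longrightarrow> f j = f k \<and> l j = l k"
      and fl_S: "\<And>k. k \<in> S \<Longrightarrow> Suc k \<le> l k"
    using maximal_blocks[of S n, OF S] by metis
  define X where "X = {t \<in> PiE {..<n} (\<lambda>c. {s c..e c}). \<forall>c\<in>S. t c < t (Suc c)}"
  define r where "r k = f k + l k - k" for k
  define \<phi> where "\<phi> t = (\<lambda>k\<in>{..<n}. s (f k) + e (l k) - t (r k))" for t
  have r: "f k \<le> r k" "r k \<le> l k" "r (r k) = k" "f (r k) = f k" "l (r k) = l k" for k
    using fl(1,2)[of k] fl_eq[of k "r k"] by (auto simp: r_def)
  have r_n: "r k < n" if "k < n" for k using r(2)[of k] fl(3)[OF that] by simp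
  have mono: "t j < t i" if "t \<in> X" "f k \<le> j" "j < i" "i \<le> l k" for t i j k
    using that(3,4)
  proof (induction i)
    case (Suc i)
    have "i \<in> S" using fl(4)[of k] Suc.prems that(2) by auto
    then have "t i < t (Suc i)" using that(1) by (auto simp: X_def)
    then show ?case using Suc by (cases "j = i") auto
  qed simp
  have range: "s k \<le> t k" "t k \<le> e k" if "t \<in> X" "k < n" for t k
    using that by (auto simp: X_def)
  have t_bounds: "s (f k) \<le> t j" "t j \<le> e (l k)" if "t \<in> X" "k < n" "f k \<le> j" "j \<le> l k" for t j k
  proof -
    have n: "f k < n" "l k < n" using fl(1)[of k] fl(3) that(2) by auto
    show "s (f k) \<le> t j"
      using mono[OF that(1), of k "f k" j] range(1)[OF that(1) n(1)] that by (cases "j = f k") auto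
    show "t j \<le> e (l k)"
      using mono[OF that(1), of k j "l k"] range(2)[OF that(1) n(2)] that by (cases "j = l k") auto
  qed
  have se: "s k \<le> s (f k)" "e (l k) \<le> e k" if "k < n" for k
    using anti fl that by auto
  have \<phi>_X: "\<phi> t \<in> X" if t: "t \<in> X" for t
  proof -
    have "\<phi> t k \<in> {s k..e k}" if "k < n" for k
      using se[OF that] t_bounds[OF t that r(1,2)] that by (auto simp: \<phi>_def)
    moreover have "\<phi> t c < \<phi> t (Suc c)" if "c \<in> S" for c
    proof -
      have n: "c < n" "Suc c < n" using S[OF that] by auto
      have le: "Suc c \<le> l c" using fl_S[OF that] .
      have eq: "f (Suc c) = f c" "l (Suc c) = l c" using fl_eq[of c "Suc c"] fl(1)[of c] le by auto
      have "f c \<le> r (Suc c)" "r (Suc c) < r c"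
        using fl(1)[of c] le by (auto simp: r_def eq)
      then have "t (r (Suc c)) < t (r c)" using mono[OF t, of c] r(2) by simp
      \<comment> \<open>Both \<open>r\<close> and the subtraction reverse the order, so strict
        increase survives. As \<open>t (r c) \<le> e (l c)\<close>, the subtraction on naturals does
        not truncate.\<close>
      then show ?thesis
        using n t_bounds[OF t n(1) r(1,2)] by (simp add: \<phi>_def eq)
    qed
    ultimately show ?thesis by (auto simp: X_def \<phi>_def)
  qed
  have \<phi>_\<phi>: "\<phi> (\<phi> t) = t" if t: "t \<in> X" for t
  proof
    fix k
    show "\<phi> (\<phi> t) k = t k"
      using t_bounds[OF t _ fl(1,2), of k] r_n[of k] r[of k] t
      by (auto simp: \<phi>_def X_def PiE_def extensional_def)
  qed
  \<comment> \<open>At the first position of a block \<open>r k = l k\<close>, and the equivalence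
    is arithmetic. At later positions both sides hold: strict increase lifts
    \<open>\<phi> t k\<close> above \<open>s (f k)\<close> and keeps \<open>t (r k)\<close> below
    \<open>e (l k)\<close>.\<close>
  have low: "s k < \<phi> t k \<longleftrightarrow> t (r k) < e (r k)" if t: "t \<in> X" and k: "k < n" for t k
  proof (cases "k = f k")
    case True
    then have "r k = l k" by (simp add: r_def)
    then show ?thesis
      using True k t_bounds[OF t k r(1,2)] by (auto simp: \<phi>_def)
  next
    case False
    then have "f k < k" using fl(1)[of k] by simp
    then have "s k < \<phi> t k"
      using mono[OF \<phi>_X[OF t], of k "f k" k] fl(2)[of k] t_bounds[OF \<phi>_X[OF t] k, of "f k"] 
        fl(1,2)[of k] se[OF k] by auto
    moreover have "t (r k) < e (r k)"
    proof -
      have "r k < l k" using \<open>f k < k\<close> fl(2)[of k] by (auto simp: r_def)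
      then have "t (r k) < t (l k)" using mono[OF t, of k] r(1) by simp
      also have "\<dots> \<le> e (l k)" using t_bounds[OF t k, of "l k"] fl(1,2)[of k] by auto
      also have "\<dots> \<le> e (r k)" using se(2)[OF r_n[OF k]] by (simp add: r)
      finally show ?thesis .
    qed
    ultimately show ?thesis by simp
  qed
  have swap1: "card {c. c < n \<and> s c < \<phi> t c} = card {c. c < n \<and> t c < e c}" if "t \<in> X" for t
    by (rule bij_betw_same_card[of r], rule bij_betw_byWitness[where f' = r])
      (use low[OF that] r r_n in auto)
  have swap2: "card {c. c < n \<and> \<phi> t c < e c} = card {c. c < n \<and> s c < t c}" if "t \<in> X" for t
    using swap1[OF \<phi>_X[OF that]] by (simp add: \<phi>_\<phi>[OF that])
  have "bij_betw \<phi> {t \<in> X. card {c. c < n \<and> s c < t c} = a \<and> card {c. c < n \<and> t c < e c} = b}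
     {t \<in> X. card {c. c < n \<and> s c < t c} = b \<and> card {c. c < n \<and> t c < e c} = a}"
    by (rule bij_betw_byWitness[where f' = \<phi>]) (auto simp: \<phi>_\<phi> \<phi>_X swap1 swap2)
  from bij_betw_same_card[OF this] show ?thesis by (simp add: X_def conj_ac)
qed

text \<open>Block reversal needs strict ascents, whereas the sequences here have none: their ascent
  set \<open>D t\<close> is empty. Inclusion-exclusion turns this into a signed sum over sets
  \<open>S\<close> of forced ascents, and the two sums agree term by term.\<close>

lemma card_antitone_swap:
  fixes s e :: "nat \<Rightarrow> nat"
  assumes anti: "\<And>c d. c \<le> d \<Longrightarrow> d < n \<Longrightarrow> s d \<le> s c" "\<And>c d. c \<le> d \<Longrightarrow> d < n \<Longrightarrow> e d \<le> e c"
  shows "card {t \<in> PiE {..<n} (\<lambda>c. {s c..e c}). (\<forall>c. Suc c < n \<longrightarrow> t (Suc c) \<le> t c) \<and>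
           card {c. c < n \<and> s c < t c} = a \<and> card {c. c < n \<and> t c < e c} = b} =
         card {t \<in> PiE {..<n} (\<lambda>c. {s c..e c}). (\<forall>c. Suc c < n \<longrightarrow> t (Suc c) \<le> t c) \<and>
           card {c. c < n \<and> s c < t c} = b \<and> card {c. c < n \<and> t c < e c} = a}"
proof -
  define B where "B = {c. Suc c < n}"
  define D where "D t = {c. Suc c < n \<and> t c < t (Suc c)}" for t :: "nat \<Rightarrow> nat"
  define X where "X a b = {t \<in> PiE {..<n} (\<lambda>c. {s c..e c}).
    card {c. c < n \<and> s c < t c} = a \<and> card {c. c < n \<and> t c < e c} = b}" for a b
  have fin: "finite (X a b)" for a b
    unfolding X_def by (rule finite_subset[of _ "PiE {..<n} (\<lambda>c. {s c..e c})"]) (auto intro: finite_PiE)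
  have finB: "finite B" unfolding B_def by (rule finite_subset[of _ "{..<n}"]) auto
  have D_empty: "D t = {} \<longleftrightarrow> (\<forall>c. Suc c < n \<longrightarrow> t (Suc c) \<le> t c)" for t
    unfolding D_def by (metis (mono_tags, lifting) Collect_empty_eq not_less)
  have "card {t \<in> X a b. S \<subseteq> D t} = card {t \<in> X b a. S \<subseteq> D t}" if "S \<in> Pow B" for S
  proof -
    have S: "\<And>c. c \<in> S \<Longrightarrow> Suc c < n" using that by (auto simp: B_def)
    then have "S \<subseteq> D t \<longleftrightarrow> (\<forall>c\<in>S. t c < t (Suc c))" for t by (auto simp: D_def)
    then show ?thesis
      using card_block_increasing_swap[where s = s and e = e and n = n and S = S and a = a and b = b,
          OF anti S] by (simp add: X_def conj_ac)
  qed
  then have "int (card {t \<in> X a b. D t = {}}) = int (card {t \<in> X b a. D t = {}})"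
    by (subst (1 2) card_empty_fibre_alternating[OF fin finB]) (auto simp: D_def B_def)
  then show ?thesis by (simp add: D_empty X_def conj_ac)
qed

subsection \<open>Permutations of the variables\<close>

lemma lookup_map_key:
  assumes "inj f"
  shows "Poly_Mapping.lookup (Poly_Mapping.map_key f p) k = Poly_Mapping.lookup p (f k)"
  using Poly_Mapping.map_key.rep_eq[of f p] assms by simp

text \<open>The sets \<open>A - \<sigma>\<close> A\<open>and\<close>\<sigma> \<open>A - A\<close>
  have equal size, so any bijection from the second back to the first completes the restriction of
  \<open>\<sigma>\<close> to a permutation of a finite set. Such a permutation is a product of
  transpositions, which \<open>\<sigma>\<close> itself need not be.\<close>

lemma finite_permutation_agreeing_on:
  fixes \<sigma> :: "'a \<Rightarrow> 'a"
  assumes "inj \<sigma>" "finite A"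
  obtains \<tau> where "\<tau> permutes (A \<union> \<sigma> ` A)" "\<And>x. x \<in> A \<Longrightarrow> \<tau> x = \<sigma> x"
proof -
  have inj: "inj_on \<sigma> A" using assms(1) by (rule inj_on_subset) simp
  have "card (\<sigma> ` A - A) = card (A - \<sigma> ` A)"
    using assms(2) card_image[OF inj] by (simp add: card_le_sym_Diff card_Diff_subset_Int Int_commute)
  then obtain h where h: "bij_betw h (\<sigma> ` A - A) (A - \<sigma> ` A)"
    using assms(2) finite_same_card_bij[of "\<sigma> ` A - A" "A - \<sigma> ` A"] by auto
  define \<tau> where "\<tau> x = (if x \<in> A then \<sigma> x else if x \<in> \<sigma> ` A then h x else x)" for x
  have "bij_betw \<tau> A (\<sigma> ` A)"
    using inj by (auto simp: \<tau>_def bij_betw_def inj_on_def)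
  moreover have "bij_betw \<tau> (\<sigma> ` A - A) (A - \<sigma> ` A)"
    using h by (subst bij_betw_cong[where g = h]) (auto simp: \<tau>_def)
  ultimately have "bij_betw \<tau> (A \<union> (\<sigma> ` A - A)) (\<sigma> ` A \<union> (A - \<sigma> ` A))"
    by (rule bij_betw_combine) auto
  then have "bij_betw \<tau> (A \<union> \<sigma> ` A) (A \<union> \<sigma> ` A)" by (simp add: Un_commute)
  then have "\<tau> permutes (A \<union> \<sigma> ` A)"
    by (rule bij_imp_permutes) (auto simp: \<tau>_def)
  then show ?thesis using that by (simp add: \<tau>_def)
qed

text \<open>Induction on \<open>b - a\<close>: conjugating the transposition of \<open>Suc a\<close>
  and \<open>b\<close> by that of \<open>a\<close> and \<open>Suc a\<close> gives the transposition
  of \<open>a\<close> and \<open>b\<close>.\<close>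

lemma transpose_invariant_of_adjacent:
  fixes f :: "(nat \<Rightarrow>\<^sub>0 'a::zero) \<Rightarrow> 'b"
  assumes adj: "\<And>k p. k \<ge> m \<Longrightarrow> f (Poly_Mapping.map_key (transpose k (Suc k)) p) = f p"
  assumes "m \<le> a" "a < b"
  shows "f (Poly_Mapping.map_key (transpose a b) p) = f p"
  using assms(3,2)
proof (induction "b - a" arbitrary: a p)
  case (Suc d)
  show ?case
  proof (cases "b = Suc a")
    case False
    have "transpose a b = transpose a (Suc a) \<circ> transpose (Suc a) b \<circ> transpose a (Suc a)"
      using False Suc.prems by (simp add: transpose_comp_triple)
    then have "Poly_Mapping.map_key (transpose a b) p =
      Poly_Mapping.map_key (transpose a (Suc a)) (Poly_Mapping.map_key (transpose (Suc a) b)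
        (Poly_Mapping.map_key (transpose a (Suc a)) p))"
      by (simp add: Poly_Mapping.map_key_compose inj_compose o_assoc)
    then show ?thesis
      using Suc.hyps(1)[of "Suc a"] Suc.hyps(2) Suc.prems False adj by simp
  qed (use Suc adj in simp)
qed simp

text \<open>Although \<open>\<sigma>\<close> may move infinitely many indices, \<open>p\<close> has
  finitely many keys. Hence \<open>\<sigma>\<close> acts on \<open>p\<close> like some finite
  permutation \<open>\<tau>\<close>, which factors into transpositions.\<close>

lemma permutes_invariant_of_adjacent:
  fixes f :: "(nat \<Rightarrow>\<^sub>0 'a::zero) \<Rightarrow> 'b"
  assumes adj: "\<And>k p. k \<ge> m \<Longrightarrow> f (Poly_Mapping.map_key (transpose k (Suc k)) p) = f p"
  assumes \<sigma>: "\<sigma> permutes {m..}"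
  shows "f (Poly_Mapping.map_key \<sigma> p) = f p"
proof -
  \<comment> \<open>Keys below \<open>m\<close> are left out so that \<open>\<tau>\<close> moves
    only indices in \<open>{m..}\<close>, where adjacent invariance is available.\<close>
  define A where "A = \<sigma> -` (Poly_Mapping.keys p \<inter> {m..})"
  have inj: "inj \<sigma>" using \<sigma> by (rule permutes_inj)
  have "finite A" unfolding A_def by (rule finite_vimageI) (auto simp: inj)
  then obtain \<tau> where \<tau>: "\<tau> permutes (A \<union> \<sigma> ` A)" and \<tau>_eq: "\<And>x. x \<in> A \<Longrightarrow> \<tau> x = \<sigma> x"
    using finite_permutation_agreeing_on[OF inj] by metis
  have A_sub: "A \<union> \<sigma> ` A \<subseteq> {m..}"
    using permutes_in_image[OF \<sigma>] by (auto simp: A_def)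
  have "Poly_Mapping.map_key \<sigma> p = Poly_Mapping.map_key \<tau> p"
  proof (rule poly_mapping_eqI)
    fix k
    have "Poly_Mapping.lookup p (\<sigma> k) = Poly_Mapping.lookup p (\<tau> k)"
    proof (cases "k \<in> A \<or> k \<notin> {m..}")
      case True
      then show ?thesis
        using \<tau>_eq permutes_not_in[OF \<sigma>, of k] permutes_not_in[OF \<tau>, of k] A_sub by fastforce
    next
      case False
      then have "\<sigma> k \<notin> Poly_Mapping.keys p"
        using permutes_in_image[OF \<sigma>, of k] by (auto simp: A_def)
      \<comment> \<open>Any key in \<open>{m..}\<close> is already
        \<open>\<sigma> x = \<tau> x\<close> for some \<open>x\<close> in \<open>A\<close>, so
        injectivity of \<open>\<tau>\<close> excludes a further preimage outside
        \<open>A\<close>.\<close>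
      moreover have "\<tau> k \<notin> Poly_Mapping.keys p"
      proof
        assume k: "\<tau> k \<in> Poly_Mapping.keys p"
        have "\<tau> k \<in> {m..}"
          using permutes_in_image[OF permutes_subset[OF \<tau> A_sub], of k] False by simp
        then obtain x where "x \<in> A" "\<sigma> x = \<tau> k"
          using k permutes_surj[OF \<sigma>] by (force simp: A_def dest: surjD[of \<sigma> "\<tau> k"])
        then show False
          using \<tau>_eq[of x] permutes_inj[OF \<tau>] False by (auto dest: injD)
      qed
      ultimately show ?thesis by (simp add: in_keys_iff)
    qed
    then show "Poly_Mapping.lookup (Poly_Mapping.map_key \<sigma> p) k =
        Poly_Mapping.lookup (Poly_Mapping.map_key \<tau> p) k"
      by (simp add: lookup_map_key inj permutes_inj[OF \<tau>])
  qed
  also have "f (Poly_Mapping.map_key \<tau> p) = f p"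
    using \<tau> finite_UnI[OF \<open>finite A\<close> finite_imageI[OF \<open>finite A\<close>, of \<sigma>]]
  proof (induction arbitrary: p rule: permutes_induct)
    case (swap a b \<pi>)
    have "f (Poly_Mapping.map_key (transpose a b) p) = f p" for p
      using transpose_invariant_of_adjacent[of m f a b p, OF adj]
        transpose_invariant_of_adjacent[of m f b a p, OF adj] swap.hyps A_sub
      by (cases a b rule: linorder_cases) (auto simp: transpose_commute)
    then show ?case
      using swap permutes_inj[OF swap.hyps(4)]
      by (simp add: Poly_Mapping.map_key_compose[symmetric] del: o_apply)
  qed (simp add: id_def Poly_Mapping.map_key_id)
  finally show ?thesis .
qed

text \<open>Each column counted for \<open>i\<close> has a box with entry \<open>i\<close>, and
  distinct columns give distinct boxes. Grouping the boxes by entry then bounds the degree by the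
  number of boxes.\<close>

lemma monom_degree_rpp_monom_le:
  "monom_degree (rpp_monom lam mu T) \<le> card (skew_diagram lam mu)"
proof -
  let ?D = "skew_diagram lam mu"
  have "num_columns_containing lam mu T i \<le> card {b \<in> ?D. T b = i}" for i
  proof -
    have "{c. \<exists>r. (r, c) \<in> ?D \<and> T (r, c) = i} = snd ` {b \<in> ?D. T b = i}" by force
    then show ?thesis
      unfolding num_columns_containing_def by (simp add: card_image_le finite_skew_diagram)
  qed
  then have "monom_degree (rpp_monom lam mu T) \<le> (\<Sum>i\<in>T ` ?D. card {b \<in> ?D. T b = i})"
    unfolding monom_degree_def keys_rpp_monom lookup_rpp_monom by (rule sum_mono)
  also have "\<dots> = card ?D"
    using sum.image_gen[OF finite_skew_diagram, of "\<lambda>_. 1 :: nat" lam mu T] by simp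
  finally show ?thesis .
qed

subsection \<open>Reverse plane partitions\<close>

lemma young_diagram_down_closed:
  assumes "is_partition lam" "(r', c') \<in> young_diagram lam" "r \<le> r'" "c \<le> c'"
  shows "(r, c) \<in> young_diagram lam"
proof -
  have "lam ! r' \<le> lam ! r"
    using assms sorted_wrt_nth_less[of "(\<ge>)" lam r r']
    by (cases "r = r'") (auto simp: is_partition_def young_diagram_def)
  then show ?thesis using assms by (auto simp: young_diagram_def)
qed

lemma young_diagram_column_less:
  assumes "is_partition lam" "(r, c) \<in> young_diagram lam"
  shows "c < lam ! 0"
  using young_diagram_down_closed[OF assms, of 0 c] by (auto simp: young_diagram_def)

lemma down_closed_eq_lessThan_card:
  fixes R :: "nat set"
  assumes "finite R" "\<And>i j. j \<in> R \<Longrightarrow> i \<le> j \<Longrightarrow> i \<in> R"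
  shows "R = {..<card R}"
proof (rule card_subset_eq[symmetric])
  show "{..<card R} \<subseteq> R"
  proof
    fix i assume i: "i \<in> {..<card R}"
    show "i \<in> R"
    proof (rule ccontr)
      assume "i \<notin> R"
      then have "R \<subseteq> {..<i}" using assms(2) by (force simp: not_le[symmetric])
      then show False using i card_mono[of "{..<i}" R] by simp
    qed
  qed
qed (use assms in auto)

text \<open>The boxes of column \<open>c\<close> that belong to \<open>mu\<close> or have an entry at most \<open>j\<close> are its topmost
  \<open>height lam mu T j c\<close> ones; the boxes of \<open>mu\<close> count, so that heights decrease weakly in \<open>c\<close>.\<close>

definition height :: "nat list \<Rightarrow> nat list \<Rightarrow> (nat \<times> nat \<Rightarrow> nat) \<Rightarrow> nat \<Rightarrow> nat \<Rightarrow> nat" where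
  "height lam mu T j c = card {r. (r, c) \<in> young_diagram lam \<and> ((r, c) \<in> young_diagram mu \<or> T (r, c) \<le> j)}"

text \<open>This records what the exchange of \<open>k\<close> and \<open>Suc k\<close> keeps fixed:
  the other entries and the set of boxes holding one of these two. Fillings are compared fibre by
  fibre.\<close>

definition merge :: "nat list \<Rightarrow> nat list \<Rightarrow> nat \<Rightarrow> (nat \<times> nat \<Rightarrow> nat) \<Rightarrow> nat \<times> nat \<Rightarrow> nat" where
  "merge lam mu k T = (\<lambda>b\<in>skew_diagram lam mu. if T b = Suc k then k else T b)"

context
  fixes lam mu :: "nat list"
  assumes skew: "is_skew_shape lam mu"
begin

section \<open>Column heights of a reverse plane partition\<close>

lemma rpps_row_mono:
  "T \<in> rpps lam mu \<Longrightarrow> (r, c) \<in> skew_diagram lam mu \<Longrightarrow> (r, c') \<in> skew_diagram lam mu \<Longrightarrow> c \<le> c'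
    \<Longrightarrow> T (r, c) \<le> T (r, c')"
  by (auto simp: rpps_def)

lemma rpps_column_mono:
  "T \<in> rpps lam mu \<Longrightarrow> (r, c) \<in> skew_diagram lam mu \<Longrightarrow> (r', c) \<in> skew_diagram lam mu \<Longrightarrow> r \<le> r'
    \<Longrightarrow> T (r, c) \<le> T (r', c)"
  by (auto simp: rpps_def)

lemma down_closed:
  assumes "r \<le> r'" "c \<le> c'"
  shows "(r', c') \<in> young_diagram lam \<Longrightarrow> (r, c) \<in> young_diagram lam"
    "(r', c') \<in> young_diagram mu \<Longrightarrow> (r, c) \<in> young_diagram mu"
  using assms skew young_diagram_down_closed by (auto simp: is_skew_shape_def)

text \<open>The rows counted by \<open>height\<close> form an initial segment, because
  \<open>mu\<close> is closed upwards in a column and entries increase downwards. Membership is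
  therefore a comparison with the cardinality.\<close>

lemma less_height_iff:
  assumes T: "T \<in> rpps lam mu"
  shows "r < height lam mu T j c \<longleftrightarrow>
    (r, c) \<in> young_diagram lam \<and> ((r, c) \<in> young_diagram mu \<or> T (r, c) \<le> j)"
proof -
  let ?R = "{r. (r, c) \<in> young_diagram lam \<and> ((r, c) \<in> young_diagram mu \<or> T (r, c) \<le> j)}"
  have "finite ?R"
    by (rule finite_subset[of _ "{..<length lam}"]) (auto simp: young_diagram_def)
  moreover have "r \<in> ?R" if "r' \<in> ?R" "r \<le> r'" for r r'
  proof -
    have "(r, c) \<in> young_diagram lam" using that down_closed(1)[of r r' c c] by auto
    moreover have "T (r, c) \<le> j" if "(r, c) \<notin> young_diagram mu"
    proof -
      have "(r', c) \<notin> young_diagram mu" using down_closed(2) \<open>r \<le> r'\<close> that by blast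
      then have "T (r, c) \<le> T (r', c)" "T (r', c) \<le> j"
        using rpps_column_mono[OF T, of r c r'] \<open>r' \<in> ?R\<close> \<open>r \<le> r'\<close> that calculation
        by (auto simp: skew_diagram_def)
      then show ?thesis by simp
    qed
    ultimately show ?thesis by auto
  qed
  ultimately have "?R = {..<height lam mu T j c}"
    unfolding height_def by (rule down_closed_eq_lessThan_card)
  then show ?thesis by (simp add: set_eq_iff)
qed

text \<open>Otherwise the first row not counted in column \<open>c\<close> is counted in column
  \<open>c'\<close>. Moving left in that row contradicts the closure of \<open>mu\<close> or the
  monotonicity of the row.\<close>

lemma height_antitone:
  assumes T: "T \<in> rpps lam mu" and "c \<le> c'"
  shows "height lam mu T j c' \<le> height lam mu T j c"
proof (rule ccontr)
  define r where "r = height lam mu T j c"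
  assume "\<not> ?thesis"
  then have "r < height lam mu T j c'" by (simp add: r_def)
  then have r': "(r, c') \<in> young_diagram lam" "(r, c') \<in> young_diagram mu \<or> T (r, c') \<le> j"
    using less_height_iff[OF T] by auto
  have "\<not> r < height lam mu T j c" by (simp add: r_def)
  moreover have "(r, c) \<in> young_diagram lam" using down_closed(1)[OF order_refl \<open>c \<le> c'\<close> r'(1)] .
  ultimately have r: "(r, c) \<notin> young_diagram mu" "j < T (r, c)"
    using less_height_iff[OF T, of r j c] by auto
  then have "(r, c') \<notin> young_diagram mu" using down_closed(2)[OF order_refl \<open>c \<le> c'\<close>] by blast
  then have "T (r, c) \<le> T (r, c')" "T (r, c') \<le> j"
    using rpps_row_mono[OF T _ _ \<open>c \<le> c'\<close>] r r' \<open>(r, c) \<in> young_diagram lam\<close>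
    by (auto simp: skew_diagram_def)
  then show False using r by simp
qed

lemma height_mono:
  assumes T: "T \<in> rpps lam mu" and "i \<le> j"
  shows "height lam mu T i c \<le> height lam mu T j c"
proof (rule ccontr)
  assume "\<not> ?thesis"
  then show False
    using less_height_iff[OF T, of "height lam mu T j c" i c] \<open>i \<le> j\<close>
      less_height_iff[OF T, of "height lam mu T j c" j c] by auto
qed

text \<open>The entries \<open>j\<close> of column \<open>c\<close> fill the rows from the height at
  \<open>j - 1\<close> up to, but excluding, the height at \<open>j\<close>. The first of these rows
  serves as the witness.\<close>

lemma column_contains_iff:
  assumes T: "T \<in> rpps lam mu" and "j \<ge> 1"
  shows "(\<exists>r. (r, c) \<in> skew_diagram lam mu \<and> T (r, c) = j) \<longleftrightarrow>
    height lam mu T (j - 1) c < height lam mu T j c"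
proof
  assume "\<exists>r. (r, c) \<in> skew_diagram lam mu \<and> T (r, c) = j"
  then obtain r where "(r, c) \<in> skew_diagram lam mu" "T (r, c) = j" by auto
  then have "r < height lam mu T j c" "\<not> r < height lam mu T (j - 1) c"
    using less_height_iff[OF T, of r] \<open>j \<ge> 1\<close> by (auto simp: skew_diagram_def)
  then show "height lam mu T (j - 1) c < height lam mu T j c" by simp
next
  assume "height lam mu T (j - 1) c < height lam mu T j c"
  then show "\<exists>r. (r, c) \<in> skew_diagram lam mu \<and> T (r, c) = j"
    using less_height_iff[OF T, of "height lam mu T (j - 1) c" j c]
      less_height_iff[OF T, of "height lam mu T (j - 1) c" "j - 1" c]
    by (intro exI[of _ "height lam mu T (j - 1) c"]) (auto simp: skew_diagram_def)
qed

section \<open>Fibres of \<open>merge\<close> as sets of cut sequences\<close>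

lemma merge_eqD:
  assumes "merge lam mu k T = merge lam mu k U" "b \<in> skew_diagram lam mu"
  shows "T b = U b \<or> {T b, U b} \<subseteq> {k, Suc k}"
  using fun_cong[OF assms(1), of b] assms(2) by (auto simp: merge_def split: if_splits)

lemma num_columns_containing_merge_eq:
  assumes "merge lam mu k T = merge lam mu k U" "j \<noteq> k" "j \<noteq> Suc k"
  shows "num_columns_containing lam mu T j = num_columns_containing lam mu U j"
proof -
  have "T b = j \<longleftrightarrow> U b = j" if "b \<in> skew_diagram lam mu" for b
    using merge_eqD[OF assms(1) that] assms(2,3) by auto
  then show ?thesis unfolding num_columns_containing_def by (metis (no_types, lifting))
qed

text \<open>Only the threshold \<open>j = k\<close> separates the entries \<open>k\<close> and
  \<open>Suc k\<close>.\<close>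

lemma height_merge_eq:
  assumes "merge lam mu k T = merge lam mu k U" "j \<noteq> k"
  shows "height lam mu T j c = height lam mu U j c"
proof -
  have "T b \<le> j \<longleftrightarrow> U b \<le> j" if "b \<in> skew_diagram lam mu" for b
    using merge_eqD[OF assms(1) that] assms(2) by auto
  then have "(r, c) \<in> young_diagram lam \<and> ((r, c) \<in> young_diagram mu \<or> T (r, c) \<le> j) \<longleftrightarrow>
      (r, c) \<in> young_diagram lam \<and> ((r, c) \<in> young_diagram mu \<or> U (r, c) \<le> j)" for r
    by (auto simp: skew_diagram_def)
  then show ?thesis unfolding height_def by simp
qed

text \<open>Within a fibre the only freedom is where, in each column, the entries \<open>k\<close>
  give way to \<open>Suc k\<close>; the height at \<open>k\<close> is this cut. The heights at
  \<open>k - 1\<close> and \<open>Suc k\<close> are constant on the fibre and bound it, and row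
  monotonicity makes the cuts decrease weakly.\<close>

lemma bij_betw_merge_fibre:
  assumes U: "U \<in> rpps lam mu" and k: "k \<ge> 1"
    and n: "\<And>r c. (r, c) \<in> young_diagram lam \<Longrightarrow> c < n"
  shows "bij_betw (\<lambda>T. restrict (height lam mu T k) {..<n})
    {T \<in> rpps lam mu. merge lam mu k T = merge lam mu k U}
    {t \<in> PiE {..<n} (\<lambda>c. {height lam mu U (k - 1) c..height lam mu U (Suc k) c}).
      \<forall>c. Suc c < n \<longrightarrow> t (Suc c) \<le> t c}"
    (is "bij_betw _ ?F ?D")
proof -
  \<comment> \<open>The inverse map refills the boxes in which \<open>U\<close> has \<open>k\<close>
    or \<open>Suc k\<close> according to the cuts \<open>t\<close>.\<close>
  define G where "G t = (\<lambda>(r, c)\<in>skew_diagram lam mu. if U (r, c) \<in> {k, Suc k}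
    then if r < t c then k else Suc k else U (r, c))" for t :: "nat \<Rightarrow> nat"
  have n': "c < n" if "(r, c) \<in> skew_diagram lam mu" for r c
    using n that by (auto simp: skew_diagram_def)
  have anti: "t d \<le> t c" if "t \<in> ?D" "c \<le> d" "d < n" for t c d
    using that(2,3)
  proof (induction d rule: dec_induct)
    case (step d)
    then have "t (Suc d) \<le> t d" "t d \<le> t c" using that(1) by auto
    then show ?case by simp
  qed simp
  have G_rpps: "G t \<in> rpps lam mu" if t: "t \<in> ?D" for t
  proof -
    have "G t (r, c) \<ge> 1" if "(r, c) \<in> skew_diagram lam mu" for r c
      using that U k by (auto simp: G_def rpps_def)
    \<comment> \<open>The critical case has both boxes refilled: if the right one gets
      \<open>k\<close>, then \<open>r < t c' \<le> t c\<close>, so the left one gets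
      \<open>k\<close> too.\<close>
    moreover have "G t (r, c) \<le> G t (r, c')"
      if "(r, c) \<in> skew_diagram lam mu" "(r, c') \<in> skew_diagram lam mu" "c \<le> c'" for r c c'
      using that rpps_row_mono[OF U that] anti[OF t that(3) n'[OF that(2)]] by (auto simp: G_def)
    moreover have "G t (r, c) \<le> G t (r', c)"
      if "(r, c) \<in> skew_diagram lam mu" "(r', c) \<in> skew_diagram lam mu" "r \<le> r'" for r r' c
      using that rpps_column_mono[OF U that] by (auto simp: G_def)
    moreover have "G t b = undefined" if "b \<notin> skew_diagram lam mu" for b
      using that by (simp add: G_def)
    ultimately show ?thesis unfolding rpps_def by (auto intro!: PiE_I)
  qed
  have G_merge: "merge lam mu k (G t) = merge lam mu k U" for t
    by (auto simp: merge_def G_def fun_eq_iff)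
  have height_G: "height lam mu (G t) k c = t c" if t: "t \<in> ?D" and c: "c < n" for t c
  proof -
    have bounds: "height lam mu U (k - 1) c \<le> t c" "t c \<le> height lam mu U (Suc k) c"
      using t c by auto
    have "r < height lam mu (G t) k c \<longleftrightarrow> r < t c" for r
    proof
      assume "r < height lam mu (G t) k c"
      then have r: "(r, c) \<in> young_diagram lam" "(r, c) \<in> young_diagram mu \<or> G t (r, c) \<le> k"
        using less_height_iff[OF G_rpps[OF t]] by auto
      show "r < t c"
      proof (cases "(r, c) \<in> skew_diagram lam mu \<and> U (r, c) \<in> {k, Suc k}")
        case True
        then show ?thesis using r by (auto simp: G_def skew_diagram_def split: if_splits)
      next
        case False
        then have "r < height lam mu U (k - 1) c"
          using r less_height_iff[OF U, of r "k - 1" c] by (auto simp: G_def skew_diagram_def)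
        then show ?thesis using bounds by simp
      qed
    next
      assume r: "r < t c"
      then show "r < height lam mu (G t) k c"
        using less_height_iff[OF G_rpps[OF t], of r k c] bounds
          less_height_iff[OF U, of r "Suc k" c] by (auto simp: G_def skew_diagram_def)
    qed
    then show ?thesis by (metis linorder_neqE_nat less_irrefl)
  qed
  have "(\<lambda>T. restrict (height lam mu T k) {..<n}) ` ?F \<subseteq> ?D"
  proof (rule image_subsetI)
    fix T assume "T \<in> ?F"
    then have T: "T \<in> rpps lam mu" and eq: "merge lam mu k T = merge lam mu k U" by auto
    have "height lam mu U (k - 1) c = height lam mu T (k - 1) c"
      "height lam mu U (Suc k) c = height lam mu T (Suc k) c" for c
      using height_merge_eq[OF eq] k by simp_all
    then show "restrict (height lam mu T k) {..<n} \<in> ?D"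
      using height_mono[OF T] height_antitone[OF T] by auto
  qed
  moreover have "G (restrict (height lam mu T k) {..<n}) = T" if "T \<in> ?F" for T
  proof
    fix b :: "nat \<times> nat"
    obtain r c where b: "b = (r, c)" by (cases b)
    show "G (restrict (height lam mu T k) {..<n}) b = T b"
    proof (cases "b \<in> skew_diagram lam mu")
      case True
      then have "r < height lam mu T k c \<longleftrightarrow> T (r, c) \<le> k"
        using that less_height_iff[of T r k c] b by (auto simp: skew_diagram_def)
      then show ?thesis
        using True b n'[of r c] merge_eqD[of k T U b] that by (auto simp: G_def)
    next
      case False
      then show ?thesis
        using that b by (auto simp: G_def rpps_def elim: PiE_arb[symmetric])
    qed
  qed
  moreover have "restrict (height lam mu (G t) k) {..<n} = t" if "t \<in> ?D" for t
    using height_G[OF that] that by (intro ext) (auto simp: PiE_def extensional_def)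
  ultimately show ?thesis
    by (intro bij_betw_byWitness[where f' = G]) (auto simp: G_rpps G_merge)
qed

text \<open>Under the bijection with cuts \<open>t\<close>, the columns containing \<open>k\<close>
  are those with \<open>s c < t c\<close>, and those containing \<open>Suc k\<close> have
  \<open>t c < e c\<close>. The symmetry of cut sequences then carries over.\<close>

lemma card_merge_fibre_swap:
  assumes U: "U \<in> rpps lam mu" and k: "k \<ge> 1"
  shows "card {T \<in> rpps lam mu. merge lam mu k T = merge lam mu k U \<and>
      num_columns_containing lam mu T k = a \<and> num_columns_containing lam mu T (Suc k) = b} =
    card {T \<in> rpps lam mu. merge lam mu k T = merge lam mu k U \<and>
      num_columns_containing lam mu T k = b \<and> num_columns_containing lam mu T (Suc k) = a}"
proof -
  obtain n where n: "\<And>r c. (r, c) \<in> young_diagram lam \<Longrightarrow> c < n"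
    using young_diagram_column_less skew unfolding is_skew_shape_def by metis
  define s e where "s = height lam mu U (k - 1)" and "e = height lam mu U (Suc k)"
  define D where "D = {t \<in> PiE {..<n} (\<lambda>c. {s c..e c}). \<forall>c. Suc c < n \<longrightarrow> t (Suc c) \<le> t c}"
  define F where "F = {T \<in> rpps lam mu. merge lam mu k T = merge lam mu k U}"
  have bij: "bij_betw (\<lambda>T. restrict (height lam mu T k) {..<n}) F D"
    unfolding F_def D_def s_def e_def by (rule bij_betw_merge_fibre[OF U k n])
  have stat:
    "num_columns_containing lam mu T k =
      card {c. c < n \<and> s c < restrict (height lam mu T k) {..<n} c}"
    "num_columns_containing lam mu T (Suc k) =
      card {c. c < n \<and> restrict (height lam mu T k) {..<n} c < e c}" if "T \<in> F" for T
  proof -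
    have T: "T \<in> rpps lam mu" and eq: "merge lam mu k T = merge lam mu k U"
      using that by (auto simp: F_def)
    have n': "c < n" if "\<exists>r. (r, c) \<in> skew_diagram lam mu \<and> T (r, c) = j" for c j
      using that n by (auto simp: skew_diagram_def)
    have contains: "(\<exists>r. (r, c) \<in> skew_diagram lam mu \<and> T (r, c) = j) \<longleftrightarrow>
        c < n \<and> height lam mu T (j - 1) c < height lam mu T j c" if "j \<ge> 1" for c j
      using column_contains_iff[OF T that, of c] n'[of c j] by blast
    have "s = height lam mu T (k - 1)" "e = height lam mu T (Suc k)"
      using height_merge_eq[OF eq] k by (auto simp: s_def e_def fun_eq_iff)
    then show "num_columns_containing lam mu T k =
      card {c. c < n \<and> s c < restrict (height lam mu T k) {..<n} c}"
      "num_columns_containing lam mu T (Suc k) =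
      card {c. c < n \<and> restrict (height lam mu T k) {..<n} c < e c}"
      unfolding num_columns_containing_def contains[OF k] contains[of "Suc k", simplified]
      by (auto intro!: arg_cong[where f = card])
  qed
  have count: "card {T \<in> F. num_columns_containing lam mu T k = a \<and>
        num_columns_containing lam mu T (Suc k) = b} =
      card {t \<in> D. card {c. c < n \<and> s c < t c} = a \<and> card {c. c < n \<and> t c < e c} = b}" for a b
    by (rule bij_betw_same_card[OF bij_betw_subset[OF bij]])
      (use bij_betw_imp_surj_on[OF bij] stat in \<open>auto simp: image_iff\<close>)
  have "card {t \<in> D. card {c. c < n \<and> s c < t c} = a \<and> card {c. c < n \<and> t c < e c} = b} =
    card {t \<in> D. card {c. c < n \<and> s c < t c} = b \<and> card {c. c < n \<and> t c < e c} = a}"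
    using card_antitone_swap[of n s e a b] height_antitone[OF U]
    by (simp add: D_def s_def e_def conj_ac)
  then show ?thesis using count[of a b] count[of b a] by (simp add: F_def conj_ac)
qed

text \<open>Exponents other than those at \<open>k\<close> and \<open>Suc k\<close> are constant on
  each fibre of \<open>merge\<close>, so both monomials admit the same fibres. In each of them the
  two counts agree by \<open>card_merge_fibre_swap\<close>.\<close>

lemma dual_grothendieck_adjacent_swap:
  assumes k: "k \<ge> 1"
  shows "dual_grothendieck lam mu (Poly_Mapping.map_key (transpose k (Suc k)) \<beta>) =
    dual_grothendieck lam mu \<beta>"
proof -
  define X where "X \<alpha> = {T \<in> rpps lam mu. rpp_monom lam mu T = \<alpha>}" for \<alpha>
  define \<alpha> where "\<alpha> = Poly_Mapping.map_key (transpose k (Suc k)) \<beta>"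
  \<comment> \<open>There may be infinitely many fillings. Only the fibres that meet
    \<open>X \<alpha>\<close> or \<open>X \<beta>\<close> are summed over, which keeps the index set
    finite.\<close>
  define I where "I = merge lam mu k ` X \<alpha> \<union> merge lam mu k ` X \<beta>"
  have fin: "finite (X \<gamma>)" for \<gamma> unfolding X_def by (rule finite_rpps_with_monom)
  have monom_eq: "rpp_monom lam mu T = \<gamma> \<longleftrightarrow>
      (\<forall>j. num_columns_containing lam mu T j = Poly_Mapping.lookup \<gamma> j)" for T \<gamma>
    by (simp add: poly_mapping_eq_iff lookup_rpp_monom fun_eq_iff)
  have \<alpha>: "Poly_Mapping.lookup \<alpha> k = Poly_Mapping.lookup \<beta> (Suc k)"
    "Poly_Mapping.lookup \<alpha> (Suc k) = Poly_Mapping.lookup \<beta> k"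
    "\<And>j. j \<noteq> k \<Longrightarrow> j \<noteq> Suc k \<Longrightarrow> Poly_Mapping.lookup \<alpha> j = Poly_Mapping.lookup \<beta> j"
    by (simp_all add: \<alpha>_def lookup_map_key)
  have fibre: "{T \<in> X \<gamma>. merge lam mu k T = merge lam mu k U} =
      (if \<forall>j. j \<noteq> k \<and> j \<noteq> Suc k \<longrightarrow> num_columns_containing lam mu U j = Poly_Mapping.lookup \<gamma> j
       then {T \<in> rpps lam mu. merge lam mu k T = merge lam mu k U \<and>
         num_columns_containing lam mu T k = Poly_Mapping.lookup \<gamma> k \<and>
         num_columns_containing lam mu T (Suc k) = Poly_Mapping.lookup \<gamma> (Suc k)} else {})" for U \<gamma>
  proof -
    have "rpp_monom lam mu T = \<gamma> \<longleftrightarrow>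
        (\<forall>j. j \<noteq> k \<and> j \<noteq> Suc k \<longrightarrow> num_columns_containing lam mu U j = Poly_Mapping.lookup \<gamma> j) \<and>
        num_columns_containing lam mu T k = Poly_Mapping.lookup \<gamma> k \<and>
        num_columns_containing lam mu T (Suc k) = Poly_Mapping.lookup \<gamma> (Suc k)"
      if "merge lam mu k T = merge lam mu k U" for T
      unfolding monom_eq using num_columns_containing_merge_eq[OF that] by metis
    then show ?thesis by (auto simp: X_def)
  qed
  have "card {T \<in> X \<alpha>. merge lam mu k T = q} = card {T \<in> X \<beta>. merge lam mu k T = q}" if "q \<in> I" for q
  proof -
    obtain U where U: "U \<in> rpps lam mu" "q = merge lam mu k U"
      using \<open>q \<in> I\<close> by (auto simp: I_def X_def)
    show ?thesis
      unfolding U(2) fibre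
      using card_merge_fibre_swap[OF U(1) k, of "Poly_Mapping.lookup \<beta> (Suc k)" "Poly_Mapping.lookup \<beta> k"]
      by (auto simp: \<alpha>)
  qed
  moreover have "card (X \<gamma>) = (\<Sum>q\<in>I. card {T \<in> X \<gamma>. merge lam mu k T = q})"
    if "merge lam mu k ` X \<gamma> \<subseteq> I" for \<gamma>
    using sum.group[OF fin _ that, of "\<lambda>_. 1 :: nat"] by (simp add: I_def fin)
  ultimately have "card (X \<alpha>) = card (X \<beta>)" by (simp add: I_def)
  then show ?thesis by (simp add: dual_grothendieck_def X_def \<alpha>_def)
qed

end

theorem theorem9p1:
  fixes lam mu :: "nat list"
  assumes "is_skew_shape lam mu"
  shows "symmetric_function (dual_grothendieck lam mu)"
  unfolding symmetric_function_def
proof (intro conjI allI impI exI)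
  \<comment> \<open>A nonzero coefficient comes from an actual filling, from which both the support
    and the degree bound are read off.\<close>
  fix \<alpha> assume "dual_grothendieck lam mu \<alpha> \<noteq> 0"
  then obtain T where T: "T \<in> rpps lam mu" "rpp_monom lam mu T = \<alpha>"
    using finite_rpps_with_monom[of lam mu \<alpha>] by (auto simp: dual_grothendieck_def)
  show "Poly_Mapping.keys \<alpha> \<subseteq> {1..}"
    using T(1) unfolding T(2)[symmetric] keys_rpp_monom by (auto simp: rpps_def)
  show "monom_degree \<alpha> \<le> card (skew_diagram lam mu)"
    using monom_degree_rpp_monom_le T(2) by blast
next
  fix \<sigma> :: "nat \<Rightarrow> nat" assume "\<sigma> permutes {1..}"
  then show "permute_vars \<sigma> (dual_grothendieck lam mu) = dual_grothendieck lam mu"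
    using permutes_invariant_of_adjacent[where f = "dual_grothendieck lam mu" and m = 1]
      dual_grothendieck_adjacent_swap[OF assms]
    by (auto simp: permute_vars_def)
qed

end
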